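(* Let $\delta > 0$. There exists $\ell_0 = \ell_0(\delta)$ such that for all integers $\ell \geqslant \ell_0$, all $k \in \mathbb{N}$ with $k \leqslant \ell^2/\delta$, and all real $\lambda \geqslant 2$, the number of sets $S \subset \mathbb{N}$ with $|S| = \ell$, $\sum_{a \in S} a = k$ and $|S + S| \leqslant \lambda \ell$ is at most $$2^{\delta \ell} \left( \frac{(4\lambda - 3)e}{6} \right)^{\ell}.$$
   Context: $\mathbb{N} = \{1,2,3,\ldots\}$. For $A \subset \mathbb{N}$, $A + A = \{a + b : a, b \in A\}$. *)

theory Defs
  imports Complex_Main
begin

definition sumset :: "nat set \<Rightarrow> nat set" where
  "sumset A = {a + b | a b. a \<in> A \<and> b \<in> A}"

end

theory Submission
  imports Defs
begin

text \<open>
  Fix a large constant \<open>M\<close> and put \<open>N = M l\<close>. As the sum is at most \<open>l\<^sup>2 / d\<close>, only a small proportion of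
  the elements exceed \<open>N\<close>, and there are few choices for them: giving \<open>i\<close> the weight
  \<open>c\<^sup>2 exp (- c i / l)\<close>, the total weight of all finite sets is at most \<open>exp (c l)\<close>, while each
  such set has weight at least \<open>exp (- \<kappa> l)\<close> with \<open>\<kappa>\<close> small.

  The part of \<open>S\<close> inside \<open>{1..N}\<close> is handled by a container argument, phrased as a branching
  count. A state consists of sets \<open>A\<close>, \<open>D\<close> with \<open>S \<subseteq> A\<close> and \<open>{..2N} - D \<subseteq> S + S\<close>. If \<open>A\<close> has
  noticeably more than \<open>|S + S| / 2\<close> elements, a robust form of \<open>|A + A| \<ge> 2 |A| - 1\<close> yields a
  positive proportion of pairs of \<open>A\<close> with sum in \<open>D\<close>. Hence either \<open>A\<close> loses a positive
  proportion of \<open>N\<close>, or some constant-size \<open>T \<subseteq> S\<close> gives a graph \<open>{(v, v + u). u \<in> T}\<close> between \<open>A\<close> and \<open>D\<close> of large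
  average degree, and deciding whether a vertex \<open>v\<close> lies in \<open>S\<close> removes either \<open>v\<close> from \<open>A\<close> or
  many elements \<open>v + T\<close> from \<open>D\<close>. Such a search has only \<open>2 ^ o(N)\<close> leaves, and at each leaf \<open>S\<close>
  is a set of at most \<open>l\<close> elements inside a set of size about \<open>lam l / 2\<close>.
\<close>

section \<open>Supersaturation\<close>

lemma finite_sumset: "finite S \<Longrightarrow> finite (sumset S)"
proof -
  have "sumset S = (\<lambda>(a, b). a + b) ` (S \<times> S)"
    by (auto simp: sumset_def image_iff)
  then show "finite S \<Longrightarrow> finite (sumset S)"
    by simp
qed

lemma sumset_mono: "S \<subseteq> T \<Longrightarrow> sumset S \<subseteq> sumset T"
  by (auto simp: sumset_def)

text \<open>
  The sums along \<open>{Min X} \<times> Y \<union> X \<times> {Max Y}\<close> are distinct, so at most \<open>card B\<close> of these pairs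
  have their sum in \<open>B\<close>; deleting \<open>Min X\<close> and \<open>Max Y\<close> makes room for the next such hook.
\<close>

lemma sumset_supersaturation:
  fixes X Y B :: "nat set"
  assumes "finite X" "finite Y" "finite B" "card X = card Y"
    and "card B + 2 * t \<le> card X + card Y"
  shows "t ^ 2 \<le> card {(a, b) \<in> X \<times> Y. a + b \<notin> B}"
  using assms
proof (induction t arbitrary: X Y)
  case 0
  then show ?case by simp
next
  case (Suc t)
  have "X \<noteq> {}" "Y \<noteq> {}"
    using Suc.prems by auto
  define x0 y1 where "x0 = Min X" and "y1 = Max Y"
  have x0: "x0 \<in> X" "\<And>x. x \<in> X \<Longrightarrow> x0 \<le> x" and y1: "y1 \<in> Y" "\<And>y. y \<in> Y \<Longrightarrow> y \<le> y1"
    using \<open>X \<noteq> {}\<close> \<open>Y \<noteq> {}\<close> Suc.prems by (auto simp: x0_def y1_def)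
  define bad where "bad X Y = {(a, b) \<in> X \<times> Y. a + b \<notin> B}" for X Y
  define hook where "hook = {x0} \<times> Y \<union> (X - {x0}) \<times> {y1}"
  define bh where "bh = {(a, b) \<in> hook. a + b \<notin> B}"
  have hook: "finite hook" "bh \<subseteq> hook"
    using Suc.prems by (auto simp: hook_def bh_def)
  have fin_bad: "finite (bad X Y)" if "finite X" "finite Y" for X Y
    using that by (intro finite_subset[of "bad X Y" "X \<times> Y"]) (auto simp: bad_def)
  have fin: "finite hook" "finite (bad X Y)" "finite bh"
    using Suc.prems hook fin_bad by (auto intro: finite_subset)
  have inj: "inj_on (\<lambda>(a, b). a + b) hook"
  proof (rule inj_onI, clarify)
    fix a b a' b'
    assume *: "(a, b) \<in> hook" "(a', b') \<in> hook" "a + b = a' + b'"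
    show "a = a' \<and> b = b'"
      using * x0(2)[of a] x0(2)[of a'] y1(2)[of b] y1(2)[of b'] by (auto simp: hook_def)
  qed
  have "card hook = card Y + (card X - 1)"
    unfolding hook_def using Suc.prems x0 
    by (subst card_Un_disjoint) (auto simp: card_cartesian_product)
  moreover have "card hook = card bh + card (hook - bh)"
    using fin hook by (simp add: card_Diff_subset card_mono)
  moreover have "card (hook - bh) \<le> card B"
  proof (rule card_inj_on_le)
    show "inj_on (\<lambda>(a, b). a + b) (hook - bh)"
      using inj by (rule inj_on_subset) auto
  qed (use Suc.prems in \<open>auto simp: bh_def\<close>)
  moreover have "card X \<ge> 1"
    using \<open>X \<noteq> {}\<close> Suc.prems by (simp add: Suc_leI card_gt_0_iff)
  ultimately have bh: "card bh \<ge> 2 * t + 1"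
    using Suc.prems(5) by arith
  have "t ^ 2 \<le> card (bad (X - {x0}) (Y - {y1}))"
    unfolding bad_def
    by (rule Suc.IH) (use Suc.prems x0 y1 \<open>card X \<ge> 1\<close> in auto)
  moreover have "card bh + card (bad (X - {x0}) (Y - {y1})) = card (bh \<union> bad (X - {x0}) (Y - {y1}))"
    using Suc.prems fin
    by (intro card_Un_disjoint[symmetric] fin_bad) (auto simp: bh_def hook_def bad_def)
  moreover have "\<dots> \<le> card (bad X Y)"
    using fin x0 y1 by (intro card_mono) (auto simp: bh_def hook_def bad_def)
  ultimately have "(Suc t) ^ 2 \<le> card (bad X Y)"
    using bh by (simp add: power2_eq_square)
  then show ?case
    by (simp add: bad_def)
qed
section \<open>Branching\<close>

text \<open>A node of the search tree: numbers up to \<open>2 * N\<close> outside \<open>D\<close>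
  are already certified as sums. \<open>F\<close> is a parameter so that it can be narrowed to the
  sets containing a given \<open>T\<close>.\<close>

definition between :: "nat set set \<Rightarrow> nat \<Rightarrow> nat set \<Rightarrow> nat set \<Rightarrow> nat set set" where
  "between F N A D = {S \<in> F. S \<subseteq> A \<and> {..2 * N} - D \<subseteq> sumset S}"

lemma finite_between: "finite F \<Longrightarrow> finite (between F N A D)"
  by (simp add: between_def)

text \<open>The edge from \<open>v\<close> to \<open>v + u\<close> is stored as
  \<open>(v, u)\<close>, so that edges can be counted along either coordinate.\<close>

definition shift_edges :: "nat set \<Rightarrow> nat set \<Rightarrow> nat set \<Rightarrow> (nat \<times> nat) set" where
  "shift_edges T A D = {(v, u) \<in> A \<times> T. v + u \<in> D}"

lemma finite_shift_edges: "finite A \<Longrightarrow> finite T \<Longrightarrow> finite (shift_edges T A D)"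
  by (rule finite_subset[of _ "A \<times> T"]) (auto simp: shift_edges_def)

lemma card_shift_edges_remove_left:
  assumes "finite A" "finite T"
  shows "card (shift_edges T A D) \<le> card (shift_edges T (A - {v}) D) + card T"
proof -
  have "card (shift_edges T A D) \<le> card (shift_edges T (A - {v}) D \<union> {v} \<times> T)"
    using assms by (intro card_mono finite_UnI finite_shift_edges) (auto simp: shift_edges_def)
  also have "\<dots> \<le> card (shift_edges T (A - {v}) D) + card ({v} \<times> T)"
    by (rule card_Un_le)
  finally show ?thesis
    by (simp add: card_cartesian_product)
qed

text \<open>An edge ending in \<open>w\<close> is recovered from its label \<open>u\<close> as
  \<open>(w - u, u)\<close>, so degrees on the right are at most \<open>card T\<close> too.\<close>

lemma card_shift_edges_remove_right:
  assumes "finite A" "finite T" "finite W"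
  shows "card (shift_edges T A D) \<le> card (shift_edges T A (D - W)) + card T * card W"
proof -
  have "shift_edges T A D \<subseteq> shift_edges T A (D - W) \<union> (\<lambda>(w, u). (w - u, u)) ` (W \<times> T)"
    by (force simp: shift_edges_def image_iff)
  then have "card (shift_edges T A D) \<le> card (shift_edges T A (D - W) \<union> (\<lambda>(w, u). (w - u, u)) ` (W \<times> T))"
    using assms by (intro card_mono) (auto simp: finite_shift_edges)
  also have "\<dots> \<le> card (shift_edges T A (D - W)) + card ((\<lambda>(w, u). (w - u, u)) ` (W \<times> T))"
    by (rule card_Un_le)
  also have "card ((\<lambda>(w, u). (w - u, u)) ` (W \<times> T)) \<le> card (W \<times> T)"
    using assms by (intro card_image_le) auto
  finally show ?thesis
    by (simp add: card_cartesian_product mult.commute)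
qed

lemma card_shift_edges_sum:
  assumes "finite A" "finite T"
  shows "card (shift_edges T A D) = (\<Sum>v\<in>A. card {u \<in> T. v + u \<in> D})"
proof -
  have "shift_edges T A D = (SIGMA v:A. {u \<in> T. v + u \<in> D})"
    by (auto simp: shift_edges_def)
  then show ?thesis
    using assms by simp
qed

lemma card_shift_edges_sum':
  assumes "finite A" "finite T"
  shows "card (shift_edges T A D) = (\<Sum>u\<in>T. card {v \<in> A. u + v \<in> D})"
proof -
  have "shift_edges T A D = prod.swap ` (SIGMA u:T. {v \<in> A. u + v \<in> D})"
    by (fastforce simp: shift_edges_def add.commute image_iff)
  then show ?thesis
    using assms by (simp add: card_image)
qed

text \<open>
  Branching on a vertex \<open>v\<close> of large degree: either \<open>v \<notin> S\<close> and \<open>v\<close> is deleted from \<open>A\<close>, or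
  \<open>v \<in> S\<close> and, since \<open>T \<subseteq> S\<close>, all of \<open>v + T\<close> is deleted from \<open>D\<close>. The hypothesis on \<open>x\<close> makes
  the weight \<open>x ^ (card A + card D)\<close> absorb both branches.
\<close>

lemma card_between_branching:
  fixes x R :: real
  assumes "finite F" and T: "finite T" "\<And>S. S \<in> F \<Longrightarrow> T \<subseteq> S"
    and x: "x \<ge> 1" "x ^ r \<ge> x ^ (r - 1) + 1" and r: "r \<ge> 1" and "R \<ge> 0" and "N \<ge> 1"
    and leaf: "\<And>A D. A \<subseteq> {1..N} \<Longrightarrow> D \<subseteq> {..2 * N} \<Longrightarrow> card A + card D \<le> L \<Longrightarrow>
      real (card (between F N A D)) \<le> R * x ^ (card A + card D)"
    and "A \<subseteq> {1..N}" "D \<subseteq> {..2 * N}"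
    and "r * N + card T * (card A + card D) \<le> card (shift_edges T A D) + card T * L"
  shows "real (card (between F N A D)) \<le> R * x ^ (card A + card D)"
  using assms(10-)
proof (induction "card A + card D" arbitrary: A D rule: less_induct)
  case less
  have fin: "finite A" "finite D"
    using less.prems finite_subset by auto
  show ?case
  proof (cases "card A + card D \<le> L")
    case True
    then show ?thesis
      using leaf less.prems by blast
  next
    case False
    \<comment> \<open>Since \<open>card A + card D\<close> exceeds \<open>L\<close>, the edge
      hypothesis gives more than \<open>(r - 1) * N\<close> edges out of at most \<open>N\<close>
      vertices.\<close>
    have "\<exists>v\<in>A. r \<le> card {u \<in> T. v + u \<in> D}"
    proof (rule ccontr)
      assume "\<not> ?thesis"
      then have *: "card {u \<in> T. v + u \<in> D} \<le> r - 1" if "v \<in> A" for v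
        using that by force
      have "card T * (Suc L) \<le> card T * (card A + card D)"
        using False by (intro mult_le_mono) auto
      then have "r * N + card T \<le> card (shift_edges T A D)"
        using less.prems by simp
      also have "card (shift_edges T A D) \<le> card A * (r - 1)"
        unfolding card_shift_edges_sum[OF fin(1) T(1)]
        using sum_bounded_above[of A, OF *] by simp
      also have "\<dots> \<le> N * (r - 1)"
        using card_mono[OF _ less.prems(1)] by simp
      finally have "r * N + card T \<le> N * (r - 1)" .
      moreover have "N * (r - 1) + N = r * N"
        using r by (cases r) auto
      ultimately show False
        using \<open>N \<ge> 1\<close> by linarith
    qed
    then obtain v where v: "v \<in> A" "r \<le> card {u \<in> T. v + u \<in> D}"
      by blast
    define W where "W = (+) v ` {u \<in> T. v + u \<in> D}"
    have W: "W \<subseteq> D" "finite W" "card W = card {u \<in> T. v + u \<in> D}"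
      using T by (auto simp: W_def card_image)
    have cA: "card (A - {v}) + 1 = card A"
      using v fin by (metis Suc_eq_plus1 card.remove)
    have cD: "card (D - W) + card W = card D"
      using W fin by (metis add.commute card_Diff_subset card_mono le_add_diff_inverse)
    have "between F N A D \<subseteq> between F N (A - {v}) D \<union> between F N A (D - W)"
    proof
      fix S assume S: "S \<in> between F N A D"
      show "S \<in> between F N (A - {v}) D \<union> between F N A (D - W)"
      proof (cases "v \<in> S")
        case True
        then have "W \<subseteq> sumset S"
          using S T(2) by (fastforce simp: between_def W_def sumset_def)
        then show ?thesis
          using S by (auto simp: between_def)
      qed (use S in \<open>auto simp: between_def\<close>)
    qed
    then have "card (between F N A D) \<le> card (between F N (A - {v}) D \<union> between F N A (D - W))"
      by (intro card_mono) (auto simp: finite_between assms(1))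
    also have "\<dots> \<le> card (between F N (A - {v}) D) + card (between F N A (D - W))"
      by (rule card_Un_le)
    finally have "real (card (between F N A D)) \<le>
        real (card (between F N (A - {v}) D)) + real (card (between F N A (D - W)))"
      by linarith
    \<comment> \<open>The edge hypothesis survives in both branches: each deleted element destroys
      at most \<open>card T\<close> edges and lowers \<open>card T * (card A + card D)\<close> by
      \<open>card T\<close>.\<close>
    also have "real (card (between F N (A - {v}) D)) \<le> R * x ^ (card (A - {v}) + card D)"
    proof (rule less.hyps)
      have "card T * (card A + card D) = card T * (card (A - {v}) + card D) + card T"
        by (simp flip: cA add: algebra_simps)
      then show "r * N + card T * (card (A - {v}) + card D)
          \<le> card (shift_edges T (A - {v}) D) + card T * L"
        using card_shift_edges_remove_left[OF fin(1) T(1), of D v] less.prems(3) by linarith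
    qed (use less.prems cA in auto)
    also have "real (card (between F N A (D - W))) \<le> R * x ^ (card A + card (D - W))"
    proof (rule less.hyps)
      have "card T * (card A + card D) = card T * (card A + card (D - W)) + card T * card W"
        by (simp flip: cD add: algebra_simps)
      then show "r * N + card T * (card A + card (D - W))
          \<le> card (shift_edges T A (D - W)) + card T * L"
        using card_shift_edges_remove_right[OF fin(1) T(1) W(2), of D] less.prems(3) by linarith
    qed (use less.prems cD v W r in auto)
    also have "R * x ^ (card (A - {v}) + card D) + R * x ^ (card A + card (D - W)) \<le>
        R * x ^ (card A + card D)"
    proof -
      have ge: "r \<le> card A + card D"
        using v(2) W(3) cD by linarith
      have "card A + card (D - W) \<le> card A + card D - r"
        using v(2) W(3) cD by linarith
      then have "x ^ (card A + card (D - W)) \<le> x ^ (card A + card D - r)"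
        using x by (intro power_increasing) auto
      moreover have "x ^ (card (A - {v}) + card D) = x ^ (card A + card D - r) * x ^ (r - 1)"
        using cA r ge by (simp flip: power_add cA) 
      ultimately have "x ^ (card (A - {v}) + card D) + x ^ (card A + card (D - W)) \<le>
          x ^ (card A + card D - r) * (x ^ (r - 1) + 1)"
        by (simp add: algebra_simps)
      also have "\<dots> \<le> x ^ (card A + card D - r) * x ^ r"
        using x by (intro mult_left_mono) auto
      also have "\<dots> = x ^ (card A + card D)"
        using ge by (simp flip: power_add)
      finally show ?thesis
        using \<open>R \<ge> 0\<close> by (metis distrib_left mult_left_mono)
    qed
    finally show ?thesis by simp
  qed
qed


section \<open>Iterating the branching over vertices of high degree\<close>

text \<open>A set is listed and padded with 0, which lies outside \<open>{1..N}\<close>, to a word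
  of length \<open>d\<close>.\<close>

lemma card_small_subsets_le:
  "card {T. T \<subseteq> {1..N::nat} \<and> card T \<le> d} \<le> (N + 1) ^ d"
proof -
  have "{T. T \<subseteq> {1..N} \<and> card T \<le> d} \<subseteq> (\<lambda>xs. set xs - {0}) ` {xs. set xs \<subseteq> {..N} \<and> length xs = d}"
  proof
    fix T assume T: "T \<in> {T. T \<subseteq> {1..N} \<and> card T \<le> d}"
    then have "finite T"
      using finite_subset by auto
    let ?xs = "sorted_list_of_set T @ replicate (d - card T) 0"
    have "set ?xs - {0} = T" "set ?xs \<subseteq> {..N}" "length ?xs = d"
      using T \<open>finite T\<close> by (auto split: if_splits)
    then show "T \<in> (\<lambda>xs. set xs - {0}) ` {xs. set xs \<subseteq> {..N} \<and> length xs = d}"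
      by (metis (mono_tags, lifting) image_eqI mem_Collect_eq)
  qed
  then have "card {T. T \<subseteq> {1..N} \<and> card T \<le> d} \<le> card {xs. set xs \<subseteq> {..N} \<and> length xs = d}"
    by (intro surj_card_le) (auto simp: finite_lists_length_eq)
  then show ?thesis
    by (simp add: card_lists_length_eq)
qed

text \<open>Supersaturation with \<open>{..2 * N} - D\<close> as excluded sums gives at least
  \<open>t ^ 2\<close> pairs with sum in \<open>D\<close>. Vertices of degree below \<open>h\<close>
  account for at most \<open>h * N\<close> of them, and each other vertex for at most
  \<open>N\<close>.\<close>

lemma card_high_degree_ge:
  assumes "A \<subseteq> {1..N}" "D \<subseteq> {..2 * N}" "N \<ge> 1" and ht: "2 * h * N \<le> t ^ 2"
    and "card ({..2 * N} - D) + 2 * t \<le> 2 * card A"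
  shows "h \<le> card {a \<in> A. h \<le> card {b \<in> A. a + b \<in> D}}"
proof -
  have fin: "finite A"
    using assms finite_subset by auto
  define H where "H = {a \<in> A. h \<le> card {b \<in> A. a + b \<in> D}}"
  have "H \<subseteq> A" by (auto simp: H_def)
  have cA: "card A \<le> N"
    using card_mono[OF _ assms(1)] by simp
  have "t ^ 2 \<le> card {(a, b) \<in> A \<times> A. a + b \<notin> {..2 * N} - D}"
    by (rule sumset_supersaturation) (use assms fin in auto)
  also have "{(a, b) \<in> A \<times> A. a + b \<notin> {..2 * N} - D} = (SIGMA a:A. {b \<in> A. a + b \<in> D})"
  proof -
    have "a + b \<le> 2 * N" if "a \<in> A" "b \<in> A" for a b
      using that assms(1) by (auto simp: mult_2 intro!: add_mono)
    then show ?thesis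
      by auto
  qed
  also have "card \<dots> = (\<Sum>a\<in>A. card {b \<in> A. a + b \<in> D})"
    using fin by simp
  also have "\<dots> = (\<Sum>a\<in>H. card {b \<in> A. a + b \<in> D}) + (\<Sum>a\<in>A - H. card {b \<in> A. a + b \<in> D})"
    by (subst sum.subset_diff[OF \<open>H \<subseteq> A\<close> fin]) (rule add.commute)
  also have "(\<Sum>a\<in>H. card {b \<in> A. a + b \<in> D}) \<le> card H * N"
  proof -
    have "card {b \<in> A. a + b \<in> D} \<le> N" for a
      using card_mono[OF fin, of "{b \<in> A. a + b \<in> D}"] cA by force
    then show ?thesis
      using sum_bounded_above[of H "\<lambda>a. card {b \<in> A. a + b \<in> D}" N] by simp
  qed
  also have "(\<Sum>a\<in>A - H. card {b \<in> A. a + b \<in> D}) \<le> card (A - H) * h"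
    using sum_bounded_above[of "A - H" "\<lambda>a. card {b \<in> A. a + b \<in> D}" h] by (force simp: H_def)
  also have "card (A - H) * h \<le> N * h"
    using cA card_mono[OF fin, of "A - H"] by (intro mult_right_mono) auto
  finally have "2 * h * N \<le> card H * N + N * h"
    using ht by linarith
  then have "h * N \<le> card H * N"
    by (simp add: mult.commute[of N h])
  then show ?thesis
    using \<open>N \<ge> 1\<close> by (simp add: H_def)
qed

text \<open>
  Either \<open>S\<close> has fewer than \<open>d\<close> elements in the set \<open>H\<close> of vertices of high degree, and \<open>A\<close>
  loses almost all of \<open>H\<close>, or \<open>S \<inter> H\<close> contains a \<open>d\<close>-set \<open>T\<close> for which the branching lemma
  applies until \<open>q\<close> elements are lost. In both cases the factor \<open>y ^ q\<close> gained pays for the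
  choice of \<open>T\<close>.
\<close>

lemma card_between_le:
  fixes x y K :: real
  assumes F: "\<And>S. S \<in> F \<Longrightarrow> S \<subseteq> {1..N} \<and> card (sumset S) \<le> m"
    and N: "N \<ge> 1" and r: "r \<ge> 1" and x: "x \<ge> 1" "x ^ r \<ge> x ^ (r - 1) + 1"
    and y: "y \<ge> 1" "real (N + 1) ^ d \<le> y ^ q" and K: "K \<ge> 0"
    and par: "2 * h * N \<le> t ^ 2" "r * N + d * q \<le> d * h" "q + d \<le> h" "q \<ge> 1"
    and leaf: "\<And>A. A \<subseteq> {1..N} \<Longrightarrow> 2 * card A \<le> m + 2 * t \<Longrightarrow> real (card {S \<in> F. S \<subseteq> A}) \<le> K"
    and "A \<subseteq> {1..N}" "D \<subseteq> {..2 * N}"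
  shows "real (card (between F N A D)) \<le> K * (x * y) ^ (card A + card D)"
  using assms(14-)
proof (induction "card A + card D" arbitrary: A D rule: less_induct)
  case less
  have fin: "finite A" "finite D"
    using less.prems finite_subset by auto
  have "F \<subseteq> Pow {1..N}"
    using F by auto
  then have "finite F"
    by (rule finite_subset) auto
  have xy: "x * y \<ge> 1"
    using x y by (metis mult_mono mult_1 zero_le_one order_trans)
  define P where "P = card A + card D"
  consider (empty) "between F N A D = {}" | (leaf) "2 * card A \<le> m + 2 * t"
    | (branch) S where "S \<in> between F N A D" "m + 2 * t < 2 * card A"
    by fastforce
  then show ?case
  proof cases
    case empty
    then show ?thesis using K xy by simp
  next
    case leaf
    have "real (card (between F N A D)) \<le> real (card {S \<in> F. S \<subseteq> A})"
      using \<open>finite F\<close> by (auto simp: between_def intro!: card_mono)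
    also have "\<dots> \<le> K"
      using assms(13) less.prems leaf by blast
    also have "\<dots> \<le> K * (x * y) ^ (card A + card D)"
      using K xy by (metis mult_left_mono mult_1_right one_le_power)
    finally show ?thesis .
  next
    case (branch S)
    then have S: "S \<in> F" "S \<subseteq> A" "{..2 * N} - D \<subseteq> sumset S"
      by (auto simp: between_def)
    have "finite S"
      using S fin finite_subset by auto
    then have "finite (sumset S)"
      by (rule finite_sumset)
    then have "card ({..2 * N} - D) \<le> card (sumset S)"
      using S by (intro card_mono) auto
    then have B: "card ({..2 * N} - D) + 2 * t \<le> 2 * card A"
      using F[OF S(1)] branch by linarith
    define H where "H = {a \<in> A. h \<le> card {b \<in> A. a + b \<in> D}}"
    have "H \<subseteq> A" "finite H"
      using fin by (auto simp: H_def)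
    have H: "h \<le> card H"
      unfolding H_def by (rule card_high_degree_ge) (use less.prems N par B in auto)
    have HA: "card (A - H) + card H = card A"
      using \<open>H \<subseteq> A\<close> fin by (metis add.commute card_Diff_subset card_mono finite_subset le_add_diff_inverse)
    have qP: "q \<le> P"
      using HA H par by (simp add: P_def)
    \<comment> \<open>The share of a single \<open>T\<close>: there are at most \<open>y ^ q\<close>
      choices, and \<open>y ^ q * bound\<close> is the claimed weight.\<close>
    define bound where "bound = K * x ^ P * y ^ (P - q)"
    define Ts where "Ts = {T. T \<subseteq> {1..N} \<and> card T \<le> d}"
    \<comment> \<open>The children of the node: for \<open>card T < d\<close> the set
      \<open>T\<close> is all of \<open>S \<inter> H\<close>, for \<open>card T = d\<close> only a
      part of it.\<close>
    define G where "G T = (if card T < d then between F N (A - H \<union> T) D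
      else if T \<subseteq> H then between {S \<in> F. T \<subseteq> S} N A D else {})" for T
    have "finite Ts"
      unfolding Ts_def by simp
    have G: "real (card (G T)) \<le> bound" if T: "T \<in> Ts" for T
    proof -
      have "finite T"
        using T finite_subset by (auto simp: Ts_def)
      consider "card T < d" | "card T = d" "T \<subseteq> H" | "card T = d" "\<not> T \<subseteq> H"
        using T by (force simp: Ts_def)
      then show ?thesis
      proof cases
        case 1
        define p where "p = card (A - H \<union> T) + card D"
        have "card (A - H \<union> T) \<le> card (A - H) + card T"
          by (rule card_Un_le)
        \<comment> \<open>\<open>A\<close> loses at least \<open>card H - card T\<close> elements,
          which is more than \<open>h - d \<ge> q\<close>.\<close>
        then have p: "p \<le> P - q" "p < P"
          using HA H par 1 qP unfolding P_def p_def by linarith+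
        have "real (card (G T)) \<le> K * (x * y) ^ p"
          using less.hyps[of "A - H \<union> T" D] 1 p less.prems T
          by (auto simp: G_def p_def P_def Ts_def)
        also have "\<dots> = K * (x ^ p * y ^ p)"
          by (simp add: power_mult_distrib)
        also have "\<dots> \<le> K * (x ^ P * y ^ (P - q))"
          using x y p K by (intro mult_left_mono mult_mono power_increasing) auto
        finally show ?thesis
          by (simp add: bound_def mult.assoc)
      next
        case 2
        have "card (shift_edges T A D) = (\<Sum>u\<in>T. card {v \<in> A. u + v \<in> D})"
          using fin(1) \<open>finite T\<close> by (rule card_shift_edges_sum')
        moreover have "h \<le> card {v \<in> A. u + v \<in> D}" if "u \<in> T" for u
          using 2 that by (auto simp: H_def)
        then have "card T * h \<le> (\<Sum>u\<in>T. card {v \<in> A. u + v \<in> D})"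
          using sum_bounded_below[of T h "\<lambda>u. card {v \<in> A. u + v \<in> D}"] by simp
        ultimately have e: "card (shift_edges T A D) \<ge> d * h"
          using 2 by simp
        have "real (card (between {S \<in> F. T \<subseteq> S} N A D)) \<le> (K * y ^ (P - q)) * x ^ (card A + card D)"
        \<comment> \<open>Branching stops once \<open>q\<close> elements are lost; there the
          induction hypothesis applies, with a power of \<open>y\<close> at most
          \<open>y ^ (P - q)\<close>.\<close>
        proof (rule card_between_branching[where L = "P - q" and r = r and T = T])
          fix A' D' assume *: "A' \<subseteq> {1..N}" "D' \<subseteq> {..2 * N}" "card A' + card D' \<le> P - q"
          have "real (card (between {S \<in> F. T \<subseteq> S} N A' D')) \<le> real (card (between F N A' D'))"
            using \<open>finite F\<close> by (auto simp: between_def intro!: card_mono)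
          also have "\<dots> \<le> K * (x * y) ^ (card A' + card D')"
            using * qP par less.hyps[of A' D'] by (auto simp: P_def)
          also have "\<dots> = K * (y ^ (card A' + card D') * x ^ (card A' + card D'))"
            by (simp add: power_mult_distrib)
          also have "\<dots> \<le> K * (y ^ (P - q) * x ^ (card A' + card D'))"
            using * x y K by (intro mult_left_mono mult_right_mono power_increasing) auto
          finally show "real (card (between {S \<in> F. T \<subseteq> S} N A' D'))
              \<le> K * y ^ (P - q) * x ^ (card A' + card D')"
            by (simp add: mult.assoc)
        next
          have "d * P = d * (P - q) + d * q"
            using qP by (simp flip: distrib_left)
          then show "r * N + card T * (card A + card D)
              \<le> card (shift_edges T A D) + card T * (P - q)"
            using e par(2) unfolding P_def[symmetric] 2(1) by linarith
        next
          show "0 \<le> K * y ^ (P - q)"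
            using K y(1) by simp
        qed (use \<open>finite F\<close> in \<open>simp_all add: \<open>finite T\<close> x r N less.prems del: One_nat_def\<close>)
        then show ?thesis
          using 2 by (simp add: G_def bound_def P_def mult_ac)
      next
        case 3
        then show ?thesis
          using K x y by (simp add: G_def bound_def)
      qed
    qed
    have "between F N A D \<subseteq> (\<Union>T\<in>Ts. G T)"
    proof
      fix S assume S: "S \<in> between F N A D"
      then have SN: "S \<subseteq> {1..N}" "S \<subseteq> A" "S \<in> F"
        using less.prems by (auto simp: between_def)
      have "finite (S \<inter> H)"
        using \<open>finite H\<close> by simp
      show "S \<in> (\<Union>T\<in>Ts. G T)"
      proof (cases "card (S \<inter> H) < d")
        case True
        then have "S \<inter> H \<in> Ts" "S \<in> G (S \<inter> H)"
          using SN S by (auto simp: Ts_def G_def between_def)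
        then show ?thesis by blast
      next
        case False
        then obtain T where T: "T \<subseteq> S \<inter> H" "card T = d"
          by (meson not_less obtain_subset_with_card_n)
        then have "T \<in> Ts" "S \<in> G T"
          using SN S by (auto simp: Ts_def G_def between_def)
        then show ?thesis by blast
      qed
    qed
    moreover have "finite (\<Union>T\<in>Ts. G T)"
      using \<open>finite Ts\<close> \<open>finite F\<close> by (auto simp: G_def finite_between)
    ultimately have "card (between F N A D) \<le> card (\<Union>T\<in>Ts. G T)"
      by (intro card_mono)
    also have "\<dots> \<le> (\<Sum>T\<in>Ts. card (G T))"
      using \<open>finite Ts\<close> by (rule card_UN_le)
    finally have "real (card (between F N A D)) \<le> (\<Sum>T\<in>Ts. real (card (G T)))"
      by (simp only: of_nat_le_iff flip: of_nat_sum)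
    also have "\<dots> \<le> real (card Ts) * bound"
      using G by (rule sum_bounded_above)
    also have "\<dots> \<le> y ^ q * bound"
    proof (rule mult_right_mono)
      show "real (card Ts) \<le> y ^ q"
      proof -
        have "real (card Ts) \<le> real ((N + 1) ^ d)"
          unfolding Ts_def of_nat_le_iff by (rule card_small_subsets_le)
        with y(2) show ?thesis
          by simp
      qed
    qed (use K x y in \<open>simp add: bound_def\<close>)
    also have "\<dots> = K * (x * y) ^ P"
      using qP by (simp add: bound_def power_mult_distrib power_add[symmetric])
    finally show ?thesis
      by (simp add: P_def)
  qed
qed


section \<open>Sets with small sumset in an interval\<close>

text \<open>First \<open>r\<close> is chosen from \<open>\<gamma>\<close>, then \<open>d\<close>
  from \<open>r\<close> and \<open>\<epsilon>\<close>. For large \<open>N\<close> the numbers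
  \<open>t\<close>, \<open>h\<close>, \<open>q\<close> are linear in \<open>N\<close>, so
  \<open>x ^ q\<close> outweighs the polynomial \<open>(N + 1) ^ d\<close>.\<close>

lemma container_parameters:
  fixes \<gamma> \<epsilon> :: real
  assumes "\<gamma> > 0" "\<epsilon> > 0"
  defines "x \<equiv> 2 powr \<gamma>"
  obtains r d N0 where "r \<ge> 1" "x ^ r \<ge> x ^ (r - 1) + 1"
    "\<And>N. N \<ge> N0 \<Longrightarrow> \<exists>t h q. real (N + 1) ^ d \<le> x ^ q \<and> 2 * h * N \<le> t ^ 2 \<and> r * N + d * q \<le> d * h \<and>
      q + d \<le> h \<and> q \<ge> 1 \<and> 2 * real t \<le> \<epsilon> * real N"
proof -
  have x: "x > 1"
    using assms by simp
  \<comment> \<open>This is \<open>x ^ n * (x - 1) > 1\<close>, hence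
    \<open>x ^ (n + 1) > x ^ n + 1\<close>.\<close>
  obtain n where n: "1 / (x - 1) < x ^ n"
    using real_arch_pow[OF x] by blast
  define r where "r = n + 1"
  have r: "r \<ge> 1" "x ^ r \<ge> x ^ (r - 1) + 1"
    using n x by (auto simp: r_def field_simps)
  \<comment> \<open>From \<open>t \<ge> \<epsilon> * N / 4\<close> follows
    \<open>t\<^sup>2 / (2 * N) \<ge> \<epsilon>\<^sup>2 * N / 32\<close>; the spare factor 2 absorbs
    the rounding in \<open>h\<close> and leaves \<open>h \<ge> \<tau> * N\<close>.\<close>
  define \<tau> where "\<tau> = \<epsilon>\<^sup>2 / 64"
  have \<tau>: "\<tau> > 0"
    using assms by (simp add: \<tau>_def)
  \<comment> \<open>With \<open>4 * r \<le> d * \<tau>\<close> and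
    \<open>q \<le> \<tau> * N / 2\<close>, both terms of \<open>r * N + d * q\<close> fit into
    \<open>d * \<tau> * N\<close>.\<close>
  define d where "d = nat \<lceil>4 * r / \<tau>\<rceil>"
  have d: "real d * \<tau> \<ge> 4 * r"
    using \<tau> real_nat_ceiling_ge[of "4 * r / \<tau>", folded d_def] by (simp add: divide_le_eq)
  \<comment> \<open>Through \<open>ln (N + 1) \<le> c * (N + 1)\<close> this makes
    \<open>d * ln (N + 1)\<close> at most \<open>\<gamma> * ln 2 * q\<close>, the logarithm of
    \<open>x ^ q\<close>.\<close>
  define c where "c = \<gamma> * ln 2 * \<tau> / (4 * (real d + 1))"
  have c: "c > 0"
    using assms \<tau> by (simp add: c_def)
  have "eventually (\<lambda>x::real. ln x / x < c) at_top"
    using order_tendstoD(2)[OF ln_x_over_x_tendsto_0 c] .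
  moreover have "filterlim (\<lambda>N. real (Suc N)) at_top sequentially"
    using filterlim_compose[OF filterlim_real_sequentially filterlim_Suc] .
  ultimately have ev1: "eventually (\<lambda>N. ln (real (Suc N)) / real (Suc N) < c) sequentially"
    by (rule eventually_compose_filterlim)
  \<comment> \<open>In order, the bounds absorb the rounding of \<open>t\<close> and of
    \<open>h\<close>, leave room for \<open>d\<close> in \<open>q + d \<le> h\<close>, and absorb
    the rounding of \<open>q\<close>.\<close>
  define C where "C = max (max (4 / \<epsilon>) (64 / \<epsilon>\<^sup>2)) (max (2 * d / \<tau>) (4 / \<tau> + 1))"
  have ev2: "eventually (\<lambda>N. C \<le> real N) sequentially"
    using filterlim_real_sequentially by (simp add: filterlim_at_top)
  obtain N0 where N0: "\<And>N. N \<ge> N0 \<Longrightarrow> C \<le> real N"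
      "\<And>N. N \<ge> N0 \<Longrightarrow> ln (real (Suc N)) / real (Suc N) < c"
    using eventually_conj[OF ev1 ev2] unfolding eventually_sequentially by blast
  have main: "\<exists>t h q. real (N + 1) ^ d \<le> x ^ q \<and> 2 * h * N \<le> t ^ 2 \<and> r * N + d * q \<le> d * h \<and>
      q + d \<le> h \<and> q \<ge> 1 \<and> 2 * real t \<le> \<epsilon> * real N" if "N \<ge> N0" for N
  proof -
    have C: "C \<le> real N"
      using N0 that by auto
    have N: "\<epsilon> * N \<ge> 4" "\<epsilon>\<^sup>2 * N \<ge> 64" "\<tau> * N \<ge> 2 * d" "\<tau> * N \<ge> 4 + \<tau>"
      using C assms \<tau> by (auto simp: C_def field_simps)
    have "4 / \<tau> + 1 \<le> real N"
      using C by (simp add: C_def)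
    moreover have "4 / \<tau> > 0"
      using \<tau> by simp
    ultimately have N1: "real N \<ge> 1"
      by linarith
    have "ln (real N + 1) \<le> c * (real N + 1)"
      using N0(2)[OF that] by (simp add: field_simps)
    then have "(real d + 1) * ln (real N + 1) \<le> (real d + 1) * (c * (real N + 1))"
      by (intro mult_left_mono) auto
    moreover have "(real d + 1) * (c * (real N + 1)) = \<gamma> * ln 2 * (\<tau> * (real N + 1) / 4)"
      by (simp add: c_def field_simps)
    moreover have "\<gamma> * ln 2 * (\<tau> * (real N + 1) / 4) \<le> \<gamma> * ln 2 * (\<tau> * real N / 2 - 1)"
    proof (rule mult_left_mono)
      have "\<tau> * (real N + 1) = \<tau> * real N + \<tau>"
        by (simp add: distrib_left)
      then show "\<tau> * (real N + 1) / 4 \<le> \<tau> * real N / 2 - 1"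
        using N(4) by linarith
    qed (use assms(1) in simp)
    moreover have "real d * ln (real N + 1) \<le> (real d + 1) * ln (real N + 1)"
      by (intro mult_right_mono) auto
    ultimately have ln: "d * ln (real N + 1) \<le> \<gamma> * ln 2 * (\<tau> * real N / 2 - 1)"
      by linarith
    define t where "t = nat \<lfloor>\<epsilon> * N / 2\<rfloor>"
    define h where "h = t\<^sup>2 div (2 * N)"
    define q where "q = nat \<lfloor>\<tau> * N / 2\<rfloor>"
    have t: "real t \<le> \<epsilon> * N / 2" "real t \<ge> \<epsilon> * N / 2 - 1"
      using N unfolding t_def by linarith+
    have q: "real q \<le> \<tau> * N / 2" "real q \<ge> \<tau> * N / 2 - 1"
      using N unfolding q_def by linarith+
    have hN: "2 * h * N \<le> t ^ 2"
      by (simp add: h_def mult.commute mult.left_commute) (metis div_times_less_eq_dividend mult.assoc mult.commute)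
    have "\<epsilon> * N / 4 \<le> real t"
      using t N by linarith
    then have "(\<epsilon> * N / 4)\<^sup>2 \<le> (real t)\<^sup>2"
      using assms by (intro power_mono) auto
    moreover have "(\<epsilon> * N / 4)\<^sup>2 = (\<epsilon>\<^sup>2 * N / 32) * real (2 * N)"
      by (simp add: power2_eq_square)
    ultimately have "(\<epsilon>\<^sup>2 * N / 32) * real (2 * N) \<le> (real t)\<^sup>2"
      by linarith
    then have "\<epsilon>\<^sup>2 * N / 32 \<le> (real t)\<^sup>2 / real (2 * N)"
      using N1 by (subst pos_le_divide_eq) auto
    also have "\<dots> \<le> real h + 1"
    proof -
      have "t\<^sup>2 < 2 * N + 2 * N * h"
        unfolding h_def using N1 by (intro dividend_less_times_div) auto
      then have "real (t\<^sup>2) \<le> real ((h + 1) * (2 * N))"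
        by (intro of_nat_mono) (simp add: algebra_simps)
      then have "(real t)\<^sup>2 \<le> (real h + 1) * real (2 * N)"
        by (simp only: of_nat_mult of_nat_add of_nat_power of_nat_1)
      then show ?thesis
        using N1 by (subst pos_divide_le_eq) auto
    qed
    finally have h: "real h \<ge> \<tau> * N"
      using N by (simp add: \<tau>_def)
    have "real (r * N + d * q) \<le> real d * \<tau> / 4 * N + d * (\<tau> * N / 2)"
      using d q(1) unfolding of_nat_add of_nat_mult
      by (intro add_mono mult_mono) auto
    also have "\<dots> \<le> real d * (\<tau> * N)"
      using \<tau> by (simp add: field_simps)
    also have "\<dots> \<le> d * h"
      using h by (simp add: mult_left_mono)
    finally have "r * N + d * q \<le> d * h"
      by (simp only: of_nat_le_iff)
    moreover have "q + d \<le> h"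
    proof -
      have "real q + real d \<le> real h"
        using q N h by linarith
      then show ?thesis by linarith
    qed
    moreover have "q \<ge> 1"
      using q N \<tau> by linarith
    moreover have "real (N + 1) ^ d \<le> x ^ q"
    proof -
      have "\<gamma> * ln 2 * (\<tau> * real N / 2 - 1) \<le> \<gamma> * ln 2 * real q"
        using q(2) assms(1) by (intro mult_left_mono) auto
      with ln have "real d * ln (real N + 1) \<le> \<gamma> * ln 2 * real q"
        by (rule order_trans)
      then have "exp (real d * ln (real N + 1)) \<le> exp (\<gamma> * ln 2 * real q)"
        by simp
      moreover have "exp (real d * ln (real N + 1)) = real (N + 1) ^ d"
        by (simp add: exp_of_nat_mult add.commute)
      moreover have "exp (\<gamma> * ln 2 * real q) = x ^ q"
        by (simp add: x_def powr_def exp_of_nat2_mult)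
      ultimately show ?thesis by simp
    qed
    ultimately show ?thesis
      using hN t(1) by (intro exI[of _ t] exI[of _ h] exI[of _ q]) auto
  qed
  show ?thesis
    using that[of r N0 d] r main by blast
qed

text \<open>The search starts from \<open>A = {1..N}\<close> and \<open>D = {..2 * N}\<close>, a
  state that excludes no member of \<open>F\<close>.\<close>

lemma dense_sumset_count:
  fixes \<eta> \<epsilon> :: real
  assumes "\<eta> > 0" "\<epsilon> > 0"
  obtains N0 where "\<And>N m K F. \<lbrakk>N \<ge> N0; \<And>S. S \<in> F \<Longrightarrow> S \<subseteq> {1..N} \<and> card (sumset S) \<le> m;
      \<And>A. A \<subseteq> {1..N} \<Longrightarrow> 2 * real (card A) \<le> real m + \<epsilon> * real N \<Longrightarrow> real (card {S \<in> F. S \<subseteq> A}) \<le> K\<rbrakk>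
    \<Longrightarrow> real (card F) \<le> 2 powr (\<eta> * real N) * K"
proof -
  \<comment> \<open>\<open>x\<close> serves as both weights, so the starting factor is
    \<open>2 powr (\<eta> / 4 * (3 * N + 1))\<close>, where
    \<open>3 * N + 1 \<le> 4 * N\<close>.\<close>
  define x :: real where "x = 2 powr (\<eta> / 8)"
  have x: "x \<ge> 1"
    using assms by (simp add: x_def ge_one_powr_ge_zero)
  have "\<eta> / 8 > 0"
    using assms by simp
  obtain r d N1 where r: "r \<ge> 1" "x ^ r \<ge> x ^ (r - 1) + 1" and
    par: "\<And>N. N \<ge> N1 \<Longrightarrow> \<exists>t h q. real (N + 1) ^ d \<le> x ^ q \<and> 2 * h * N \<le> t ^ 2 \<and>
      r * N + d * q \<le> d * h \<and> q + d \<le> h \<and> q \<ge> 1 \<and> 2 * real t \<le> \<epsilon> * real N"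
    by (rule container_parameters[OF \<open>\<eta> / 8 > 0\<close> \<open>\<epsilon> > 0\<close>, folded x_def]) (rule that; assumption)
  show ?thesis
  proof (rule that[of "max N1 1"])
    fix N m K F
    assume N: "N \<ge> max N1 1" and F: "\<And>S. S \<in> F \<Longrightarrow> S \<subseteq> {1..N} \<and> card (sumset S) \<le> m"
      and leaf: "\<And>A. A \<subseteq> {1..N} \<Longrightarrow> 2 * real (card A) \<le> real m + \<epsilon> * real N \<Longrightarrow>
        real (card {S \<in> F. S \<subseteq> A}) \<le> K"
    obtain t h q where thq: "real (N + 1) ^ d \<le> x ^ q" "2 * h * N \<le> t ^ 2"
        "r * N + d * q \<le> d * h" "q + d \<le> h" "q \<ge> 1" "2 * real t \<le> \<epsilon> * real N"
      using par[of N] N by auto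
    have "real (card {S \<in> F. S \<subseteq> {}}) \<le> K"
      using assms by (intro leaf) auto
    then have K: "K \<ge> 0"
      by linarith
    have "real (card (between F N {1..N} {..2 * N})) \<le> K * (x * x) ^ (card {1..N} + card {..2 * N})"
    proof (rule card_between_le[where m = m and t = t and h = h and q = q and d = d and r = r])
      fix A assume "A \<subseteq> {1..N}" "2 * card A \<le> m + 2 * t"
      then show "real (card {S \<in> F. S \<subseteq> A}) \<le> K"
        using thq(6) by (intro leaf) auto
    qed (use F N r x thq K in simp_all)
    also have "between F N {1..N} {..2 * N} = F"
      using F by (auto simp: between_def)
    also have "(x * x) ^ (card {1..N} + card {..2 * N}) = 2 powr (\<eta> / 4 * (3 * real N + 1))"
    proof -
      have "x * x = 2 powr (\<eta> / 4)"
        by (simp add: x_def flip: powr_add)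
      then have "(x * x) ^ (3 * N + 1) = (2 powr (\<eta> / 4)) powr real (3 * N + 1)"
        by (subst powr_realpow[of "2 powr (\<eta> / 4)"]) simp_all
      also have "\<dots> = 2 powr (\<eta> / 4 * (3 * real N + 1))"
        by (simp add: powr_powr add.commute)
      finally show ?thesis
        by simp
    qed
    also have "\<dots> \<le> 2 powr (\<eta> * real N)"
    proof -
      have "\<eta> * (3 * real N + 1) \<le> \<eta> * (4 * real N)"
        using N assms by (intro mult_left_mono) auto
      then show ?thesis
        by (intro powr_mono) (auto simp: field_simps)
    qed
    finally have "real (card F) \<le> K * 2 powr (\<eta> * real N)"
      using K by (simp add: mult_left_mono)
    then show "real (card F) \<le> 2 powr (\<eta> * real N) * K"
      by (simp add: mult.commute)
  qed
qed


section \<open>Weighted counting\<close>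

text \<open>Expanding the product gives the total weight \<open>prod f S\<close> of all subsets of
  \<open>A\<close>, to which each member of \<open>G\<close> contributes at least
  \<open>w\<close>.\<close>

lemma weighted_subset_count:
  fixes f :: "'a \<Rightarrow> real"
  assumes "finite A" "\<And>i. i \<in> A \<Longrightarrow> 0 \<le> f i" "G \<subseteq> Pow A" "\<And>S. S \<in> G \<Longrightarrow> w \<le> prod f S"
  shows "real (card G) * w \<le> (\<Prod>i\<in>A. 1 + f i)"
proof -
  have "real (card G) * w \<le> (\<Sum>S\<in>G. prod f S)"
    using assms(4) by (rule sum_bounded_below)
  also have "\<dots> \<le> (\<Sum>S\<in>Pow A. prod f S)"
    using assms by (intro sum_mono2) (auto intro!: prod_nonneg)
  also have "\<dots> = (\<Prod>i\<in>A. 1 + f i)"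
    using prod_add[OF assms(1), of f "\<lambda>_. 1"] by (simp add: add.commute)
  finally show ?thesis .
qed

lemma sum_exp_neg_le:
  fixes c :: real
  assumes "c > 0"
  shows "(\<Sum>i=1..k. exp (- c) ^ i) \<le> 1 / c"
proof -
  define Q where "Q = exp (- c)"
  define s where "s = (\<Sum>i=1..k. Q ^ i)"
  have "s * (1 - Q) = Q - Q ^ (k + 1)"
    unfolding s_def
  proof (induction k)
    case (Suc k)
    have "(\<Sum>i=1..Suc k. Q ^ i) * (1 - Q) = (\<Sum>i=1..k. Q ^ i) * (1 - Q) + Q ^ (k + 1) * (1 - Q)"
      by (simp add: distrib_right)
    also have "\<dots> = Q - Q ^ (Suc k + 1)"
      unfolding Suc.IH by (simp add: algebra_simps)
    finally show ?case .
  qed simp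
  then have "s * (1 - Q) \<le> Q"
    by (simp add: Q_def)
  moreover have "Q * c \<le> 1 - Q"
  proof -
    have "Q * (1 + c) \<le> Q * exp c"
      by (intro mult_left_mono) (auto simp: Q_def exp_ge_add_one_self)
    then show ?thesis
      by (simp add: Q_def exp_minus field_simps)
  qed
  moreover have "s \<ge> 0"
    by (auto simp: s_def Q_def intro!: sum_nonneg)
  ultimately have "s * (Q * c) \<le> Q"
    by (meson mult_left_mono order_trans)
  then have "s * c \<le> 1"
    by (simp add: Q_def)
  then show ?thesis
    using assms by (simp add: s_def Q_def field_simps)
qed

text \<open>With the weights \<open>f i\<close>, each of these sets weighs at least \<open>w\<close>
  because \<open>ln c \<le> 0\<close>, while \<open>1 + f i \<le> exp (f i)\<close> and a geometric
  series bound the total by \<open>exp (c * l)\<close>.\<close>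

lemma card_sparse_sets_le:
  fixes b c :: real
  assumes c: "0 < c" "c \<le> 1" and l: "l \<ge> 1"
  shows "real (card {S::nat set. S \<subseteq> {1..} \<and> finite S \<and> real (card S) \<le> b \<and> \<Sum>S \<le> k})
    \<le> exp (c * real k / real l + c * real l - 2 * b * ln c)"
proof -
  define G where "G = {S::nat set. S \<subseteq> {1..} \<and> finite S \<and> real (card S) \<le> b \<and> \<Sum>S \<le> k}"
  define f where "f i = c\<^sup>2 * exp (- (c / l)) ^ i" for i :: nat
  define w where "w = exp (2 * b * ln c - c * k / l)"
  have "real (card G) * w \<le> (\<Prod>i=1..k. 1 + f i)"
  proof (rule weighted_subset_count)
    show "G \<subseteq> Pow {1..k}"
    proof
      fix S assume S: "S \<in> G"
      have "i \<le> k" if "i \<in> S" for i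
        using member_le_sum[OF that, of "\<lambda>i. i"] S by (auto simp: G_def)
      then show "S \<in> Pow {1..k}"
        using S by (auto simp: G_def)
    qed
  next
    fix S assume S: "S \<in> G"
    have "prod f S = (c\<^sup>2) ^ card S * exp (- (c / l)) ^ \<Sum>S"
      by (simp add: f_def prod.distrib power_sum)
    also have "(c\<^sup>2) ^ card S = exp (2 * card S * ln c)"
    proof -
      have "exp (real (2 * card S) * ln c) = c ^ (2 * card S)"
        using c by (subst exp_of_nat_mult) simp
      then show ?thesis
        by (simp only: power_mult)
    qed
    also have "exp (- (c / l)) ^ \<Sum>S = exp (- (c * real (\<Sum>S) / l))"
      by (simp flip: exp_of_nat_mult)
    finally have eq: "prod f S = exp (2 * card S * ln c - c * real (\<Sum>S) / l)"
      by (simp add: exp_diff exp_minus field_simps)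
    have "2 * b * ln c \<le> 2 * card S * ln c"
      using c S by (intro mult_right_mono_neg) (auto simp: G_def)
    moreover have "c * real (\<Sum>S) / l \<le> c * k / l"
      using c S by (intro divide_right_mono mult_left_mono) (auto simp: G_def simp del: of_nat_sum)
    ultimately show "w \<le> prod f S"
      unfolding eq w_def by (simp del: of_nat_sum)
  qed (use c in \<open>auto simp: f_def\<close>)
  also have "\<dots> \<le> (\<Prod>i=1..k. exp (f i))"
    using c by (intro prod_mono) (auto simp: f_def)
  also have "\<dots> = exp (c\<^sup>2 * (\<Sum>i=1..k. exp (- (c / l)) ^ i))"
    by (simp add: exp_sum f_def sum_distrib_left)
  also have "\<dots> \<le> exp (c\<^sup>2 * (1 / (c / l)))"
    unfolding exp_le_cancel_iff using c l by (intro mult_left_mono sum_exp_neg_le) auto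
  also have "\<dots> = exp (c * l)"
    using c by (simp add: power2_eq_square)
  finally have "real (card G) * w \<le> exp (c * l)" .
  then have "real (card G) \<le> exp (c * l) / w"
    by (simp add: w_def field_simps)
  also have "\<dots> = exp (c * k / l + c * l - 2 * b * ln c)"
    unfolding w_def exp_diff[symmetric] by (simp add: algebra_simps)
  finally show ?thesis
    by (simp add: G_def)
qed

section \<open>Subsets of a single container\<close>

text \<open>Each element gets weight \<open>1 / u \<le> 1\<close>, so a set of at most
  \<open>l\<close> elements weighs at least \<open>(1 / u) ^ l\<close>.\<close>

lemma card_subsets_weight_le:
  fixes u :: real
  assumes "finite A" "u \<ge> 1"
  shows "real (card {S. S \<subseteq> A \<and> card S \<le> l}) \<le> u ^ l * (1 + 1 / u) ^ card A"
proof -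
  have "real (card {S. S \<subseteq> A \<and> card S \<le> l}) * (1 / u) ^ l \<le> (\<Prod>i\<in>A. 1 + 1 / u)"
  proof (rule weighted_subset_count)
    fix S assume "S \<in> {S. S \<subseteq> A \<and> card S \<le> l}"
    then show "(1 / u) ^ l \<le> (\<Prod>i\<in>S. 1 / u)"
      using assms unfolding prod_constant by (intro power_decreasing) auto
  qed (use assms in auto)
  then show ?thesis
    using assms by (simp add: field_simps)
qed

lemma half_le_ln_2: "1 / 2 \<le> ln (2::real)"
proof -
  have "exp (1 / 2 :: real) \<le> 1 + 1 / 2 + (1 / 2)\<^sup>2"
    by (rule exp_bound) auto
  then have "exp (1 / 2 :: real) \<le> 2"
    by (simp add: power2_eq_square)
  then show ?thesis
    by (subst ln_ge_iff) auto
qed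

text \<open>Up to \<open>lam = 3\<close> all subsets of \<open>A\<close> are counted, with base
  \<open>2 powr (lam / 2)\<close>. Beyond, the weight \<open>u = lam / 2\<close> gives base
  \<open>lam * exp 1 / 2\<close>, and \<open>3 * lam \<le> 4 * lam - 3\<close> holds exactly when
  \<open>lam \<ge> 3\<close>.\<close>

lemma card_subsets_le_base:
  fixes lam z :: real
  assumes "finite A" and lam: "lam \<ge> 2" and z: "z \<ge> 0" and A: "2 * real (card A) \<le> lam * real l + z"
  shows "real (card {S. S \<subseteq> A \<and> card S \<le> l}) \<le> ((4 * lam - 3) * exp 1 / 6) ^ l * 2 powr z"
proof (cases "lam \<le> 3")
  case True
  \<comment> \<open>The target base is \<open>(5 / 6 + 4 / 3 * s) * exp 1\<close>; a linear upper
    bound for \<open>2 powr s\<close> and \<open>5 / 2 \<le> exp 1\<close> leave a linear inequality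
    in \<open>s\<close>.\<close>
  define s where "s = lam / 2 - 1"
  have s: "0 \<le> s" "s \<le> 1 / 2"
    using True lam by (auto simp: s_def)
  have "(5 :: real) / 2 \<le> exp 1"
    using exp_lower_Taylor_quadratic[of "1::real"] by simp
  have "exp (s * ln 2) \<le> exp s"
    using s ln_le_minus_one[of "2::real"] by (simp add: mult_left_le)
  also have "\<dots> \<le> 1 + s + s\<^sup>2"
    using s by (intro exp_bound) auto
  also have "s\<^sup>2 \<le> s * (1 / 2)"
    unfolding power2_eq_square using s by (intro mult_left_mono) auto
  finally have exp_s: "exp (s * ln 2) \<le> 1 + 3 / 2 * s"
    by simp
  have "2 powr (lam / 2) = 2 powr 1 * 2 powr s"
    unfolding powr_add[symmetric] by (simp add: s_def)
  also have "\<dots> = 2 * exp (s * ln 2)"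
    by (simp add: powr_def)
  also have "\<dots> \<le> 2 * (1 + 3 / 2 * s)"
    using exp_s by simp
  also have "\<dots> \<le> (5 / 6 + 4 / 3 * s) * (5 / 2)"
    using s by (simp add: algebra_simps)
  also have "\<dots> \<le> (5 / 6 + 4 / 3 * s) * exp 1"
    using \<open>5 / 2 \<le> exp 1\<close> s by (intro mult_left_mono) auto
  also have "\<dots> = (4 * lam - 3) * exp 1 / 6"
    by (simp add: s_def field_simps)
  finally have base: "2 powr (lam / 2) \<le> (4 * lam - 3) * exp 1 / 6" .
  have "real (card {S. S \<subseteq> A \<and> card S \<le> l}) \<le> 2 powr real (card A)"
    using card_subsets_weight_le[OF assms(1), of 1 l] by (simp add: powr_realpow)
  also have "\<dots> \<le> 2 powr (lam / 2 * l + z)"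
    using A z by (intro powr_mono) auto
  also have "\<dots> = (2 powr (lam / 2)) ^ l * 2 powr z"
    by (simp add: powr_add powr_powr flip: powr_realpow)
  also have "\<dots> \<le> ((4 * lam - 3) * exp 1 / 6) ^ l * 2 powr z"
    using base by (intro mult_right_mono power_mono) auto
  finally show ?thesis .
next
  case False
  define u where "u = lam / 2"
  have u: "u \<ge> 3 / 2"
    using False by (simp add: u_def)
  have "real (card {S. S \<subseteq> A \<and> card S \<le> l}) \<le> u ^ l * (1 + 1 / u) ^ card A"
    using assms(1) u by (intro card_subsets_weight_le) auto
  also have "\<dots> \<le> u ^ l * exp (1 / u) ^ card A"
    using u by (intro mult_left_mono power_mono) auto
  also have "exp (1 / u) ^ card A = exp (card A / u)"
    by (simp flip: exp_of_nat_mult)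
  also have "\<dots> \<le> exp (l + z * ln 2)"
  proof -
    have "real (card A) \<le> u * l + z / 2"
      using A by (simp add: u_def)
    also have "\<dots> \<le> u * l + u * (z * ln 2)"
    proof -
      have "z * (1 / 2) \<le> z * ln 2"
        using z half_le_ln_2 by (intro mult_left_mono) auto
      also have "\<dots> \<le> u * (z * ln 2)"
        using mult_right_mono[of 1 u "z * ln 2"] u z by simp
      finally show ?thesis by simp
    qed
    finally show ?thesis
      using u by (simp add: field_simps)
  qed
  also have "u ^ l * exp (l + z * ln 2) = (u * exp 1) ^ l * 2 powr z"
    by (simp add: exp_add powr_def power_mult_distrib flip: exp_of_nat_mult)
  also have "\<dots> \<le> ((4 * lam - 3) * exp 1 / 6) ^ l * 2 powr z"
    using u by (intro mult_right_mono power_mono) (auto simp: u_def field_simps)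
  finally show ?thesis
    using u by simp
qed

section \<open>The counting theorem\<close>

text \<open>Markov's inequality: every element outside \<open>{..N}\<close> exceeds
  \<open>N\<close>.\<close>

lemma card_large_part_le:
  fixes S :: "nat set"
  assumes "finite S"
  shows "card (S - {..N}) * N \<le> \<Sum>S"
proof -
  have "card (S - {..N}) * N \<le> \<Sum>(S - {..N})"
    using sum_bounded_below[of "S - {..N}" N "\<lambda>i. i"] by simp
  also have "\<dots> \<le> \<Sum>S"
    using assms by (intro sum_mono2) auto
  finally show ?thesis .
qed

theorem theorem1p4:
  fixes d :: real
  assumes "d > 0"
  shows "\<exists>l0::nat. \<forall>l::nat. \<forall>k::nat. \<forall>lam::real.
           l \<ge> l0 \<longrightarrow> 1 \<le> k \<longrightarrow> real k \<le> (real l)^2 / d \<longrightarrow> lam \<ge> 2 \<longrightarrow>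
           real (card {S :: nat set. S \<subseteq> {1..} \<and> finite S \<and> card S = l \<and> \<Sum>S = k \<and>
                       real (card (sumset S)) \<le> lam * real l})
             \<le> 2 powr (d * real l) * ((4 * lam - 3) * exp 1 / 6) ^ l"
proof -
  \<comment> \<open>Makes \<open>c * k / l + c * l\<close> at most \<open>d * ln 2 / 6 * l\<close>;
    the cap \<open>1 / 2\<close> keeps \<open>ln c\<close> negative.\<close>
  define c where "c = min (1 / 2) (d * ln 2 / 6 / (1 / d + 1))"
  have c: "0 < c" "c \<le> 1 / 2"
  proof -
    have "0 < d * ln 2 / 6 / (1 / d + 1)"
      using assms by (intro divide_pos_pos mult_pos_pos add_pos_pos) auto
    then show "0 < c"
      unfolding c_def by (simp only: min_less_iff_conj) simp
    show "c \<le> 1 / 2"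
      unfolding c_def by (rule min.cobounded1)
  qed
  have "c \<le> d * ln 2 / 6 / (1 / d + 1)"
    by (simp add: c_def)
  then have c_le: "c * (1 / d + 1) \<le> d * ln 2 / 6"
    using assms by (subst (asm) pos_le_divide_eq) (auto intro: add_pos_pos)
  have ln_c: "ln c < 0"
    using c by simp
  \<comment> \<open>The affordable proportion of elements above \<open>N\<close>: their cost
    \<open>- 2 * (e * l) * ln c\<close> is another \<open>d * ln 2 / 6 * l\<close>.\<close>
  define e where "e = d * ln 2 / (12 * (- ln c))"
  have e: "e > 0" "- 2 * e * ln c = d * ln 2 / 6"
    using assms ln_c by (auto simp: e_def intro!: divide_pos_neg mult_pos_pos)
  \<comment> \<open>With \<open>N = M * l\<close>, at most
    \<open>k / N \<le> l / (d * M) \<le> e * l\<close> elements of \<open>S\<close> exceed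
    \<open>N\<close>.\<close>
  define M where "M = nat \<lceil>1 / (d * e)\<rceil>"
  have M: "real M \<ge> 1 / (d * e)"
    unfolding M_def by (rule real_nat_ceiling_ge)
  moreover have de: "1 / (d * e) > 0"
    using assms e by simp
  ultimately have M0: "M \<ge> 1"
    by linarith
  \<comment> \<open>The exponent \<open>d * l\<close> is split into thirds:
    \<open>\<eta> * N = d * l / 3\<close> pays once for the search and once for the excess size of a
    container; the last third pays for the elements above \<open>N\<close>.\<close>
  define \<eta> where "\<eta> = d / (3 * real M)"
  have \<eta>: "\<eta> > 0"
    using assms M0 by (simp add: \<eta>_def)
  obtain N0 where N0: "\<And>N m K F. \<lbrakk>N \<ge> N0; \<And>S. S \<in> F \<Longrightarrow> S \<subseteq> {1..N} \<and> card (sumset S) \<le> m;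
      \<And>A. A \<subseteq> {1..N} \<Longrightarrow> 2 * real (card A) \<le> real m + \<eta> * real N \<Longrightarrow> real (card {S \<in> F. S \<subseteq> A}) \<le> K\<rbrakk>
    \<Longrightarrow> real (card F) \<le> 2 powr (\<eta> * real N) * K"
    using dense_sumset_count[OF \<eta> \<eta>] by blast
  show ?thesis
  proof (rule exI[of _ "max 1 N0"], intro allI impI)
    fix l k :: nat and lam :: real
    assume l: "max 1 N0 \<le> l" and k: "real k \<le> (real l)\<^sup>2 / d" and lam: "2 \<le> lam"
    define X where "X = {S :: nat set. S \<subseteq> {1..} \<and> finite S \<and> card S = l \<and> \<Sum>S = k \<and>
      real (card (sumset S)) \<le> lam * real l}"
    define N where "N = M * l"
    have "1 * l \<le> N"
      unfolding N_def using M0 by (intro mult_le_mono) auto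
    then have N: "N \<ge> N0" "N \<ge> 1"
      using l by auto
    have \<eta>N: "\<eta> * real N = d * l / 3"
      using M0 by (simp add: \<eta>_def N_def)
    define m where "m = nat \<lfloor>lam * real l\<rfloor>"
    define base where "base = (4 * lam - 3) * exp 1 / 6"
    \<comment> \<open>\<open>card S \<le> l\<close> rather than equality, as the part of a set
      inside \<open>{..N}\<close> may be smaller; likewise \<open>\<Sum>S \<le> k\<close> in
      \<open>H\<close>.\<close>
    define F where "F = {S. S \<subseteq> {1..N} \<and> card S \<le> l \<and> card (sumset S) \<le> m}"
    define H where "H = {S::nat set. S \<subseteq> {1..} \<and> finite S \<and> real (card S) \<le> e * l \<and> \<Sum>S \<le> k}"
    have "finite F"
      unfolding F_def by (rule finite_subset[of _ "Pow {1..N}"]) auto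
    have "H \<subseteq> Pow {..k}"
    proof
      fix S assume S: "S \<in> H"
      have "i \<le> k" if "i \<in> S" for i
        using member_le_sum[OF that, of "\<lambda>i. i"] S by (auto simp: H_def)
      then show "S \<in> Pow {..k}"
        by auto
    qed
    then have "finite H"
      by (rule finite_subset) auto
    have "(\<lambda>S. (S \<inter> {..N}, S - {..N})) ` X \<subseteq> F \<times> H"
    proof (rule image_subsetI)
      fix S assume "S \<in> X"
      then have S: "S \<subseteq> {1..}" "finite S" "card S = l" "\<Sum>S = k" "real (card (sumset S)) \<le> lam * real l"
        by (auto simp: X_def)
      have "card (S \<inter> {..N}) \<le> l"
        using S by (metis card_mono inf_le1)
      moreover have "card (sumset (S \<inter> {..N})) \<le> card (sumset S)"
        using S by (intro card_mono finite_sumset sumset_mono) auto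
      then have "card (sumset (S \<inter> {..N})) \<le> m"
        using S(5) by (simp add: m_def le_nat_floor)
      ultimately have "S \<inter> {..N} \<in> F"
        using S(1) by (auto simp: F_def)
      moreover have "S - {..N} \<in> H"
      proof -
        have "real (card (S - {..N}) * N) \<le> real k"
          using card_large_part_le[OF S(2), of N] S(4) by (intro of_nat_mono) simp
        also have "\<dots> \<le> (real l)\<^sup>2 / d"
          by (rule k)
        also have "\<dots> = e * l * (1 / (d * e) * l)"
          using assms e by (simp add: power2_eq_square)
        also have "\<dots> \<le> e * l * real N"
          unfolding N_def of_nat_mult using M e by (intro mult_left_mono mult_right_mono) auto
        finally have "real (card (S - {..N})) \<le> e * l"
          using N by simp
        moreover have "\<Sum>(S - {..N}) \<le> \<Sum>S"
          using S by (intro sum_mono2) auto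
        ultimately show ?thesis
          using S by (auto simp: H_def)
      qed
      ultimately show "(S \<inter> {..N}, S - {..N}) \<in> F \<times> H"
        by simp
    qed
    moreover have "inj_on (\<lambda>S. (S \<inter> {..N}, S - {..N})) X"
      by (rule inj_onI) blast
    ultimately have "card X \<le> card (F \<times> H)"
      using \<open>finite F\<close> \<open>finite H\<close> by (intro card_inj_on_le) auto
    then have "real (card X) \<le> real (card F) * real (card H)"
      by (simp add: card_cartesian_product flip: of_nat_mult)
    also have "\<dots> \<le> (2 powr (d * l / 3) * (base ^ l * 2 powr (d * l / 3))) * 2 powr (d * l / 3)"
    proof (rule mult_mono)
      have "real (card F) \<le> 2 powr (\<eta> * real N) * (base ^ l * 2 powr (\<eta> * real N))"
      proof (rule N0)
        fix A assume A: "A \<subseteq> {1..N}" "2 * real (card A) \<le> real m + \<eta> * real N"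
        have "finite A"
          using A finite_subset by auto
        have "real m \<le> lam * l"
          using lam by (simp add: m_def)
        then have "real (card {S. S \<subseteq> A \<and> card S \<le> l}) \<le> base ^ l * 2 powr (\<eta> * real N)"
          unfolding base_def using A \<eta> lam \<open>finite A\<close> by (intro card_subsets_le_base) auto
        moreover have "card {S \<in> F. S \<subseteq> A} \<le> card {S. S \<subseteq> A \<and> card S \<le> l}"
          using \<open>finite A\<close> by (intro card_mono) (auto simp: F_def)
        ultimately show "real (card {S \<in> F. S \<subseteq> A}) \<le> base ^ l * 2 powr (\<eta> * real N)"
          by linarith
      qed (use N in \<open>auto simp: F_def\<close>)
      then show "real (card F) \<le> 2 powr (d * l / 3) * (base ^ l * 2 powr (d * l / 3))"
        unfolding \<eta>N .
    next
      have "real (card H) \<le> exp (c * real k / real l + c * real l - 2 * (e * l) * ln c)"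
        unfolding H_def using c l by (intro card_sparse_sets_le) auto
      also have "\<dots> \<le> exp (d * l / 3 * ln 2)"
      proof -
        have "real k / real l \<le> real l / d"
          using k l assms by (simp add: field_simps power2_eq_square)
        then have "c * (real k / real l) \<le> c * (real l / d)"
          using c by (intro mult_left_mono) auto
        then have "c * real k / real l + c * real l \<le> c * (1 / d + 1) * l"
          by (simp add: algebra_simps)
        also have "\<dots> \<le> d * ln 2 / 6 * l"
          using c_le by (intro mult_right_mono) auto
        finally have "c * real k / real l + c * real l \<le> d * ln 2 / 6 * l" .
        moreover have "- 2 * (e * l) * ln c = d * ln 2 / 6 * l"
          unfolding e(2)[symmetric] by simp
        moreover have "d * l / 3 * ln 2 = d * ln 2 / 6 * l + d * ln 2 / 6 * l"
          by simp
        ultimately show ?thesis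
          unfolding exp_le_cancel_iff by linarith
      qed
      also have "\<dots> = 2 powr (d * l / 3)"
        by (simp add: powr_def)
      finally show "real (card H) \<le> 2 powr (d * l / 3)" .
    qed (use lam in \<open>auto simp: base_def\<close>)
    also have "\<dots> = 2 powr (d * l / 3 + d * l / 3 + d * l / 3) * base ^ l"
      by (simp only: powr_add mult_ac)
    also have "\<dots> = 2 powr (d * l) * base ^ l"
      by simp
    finally show "real (card {S :: nat set. S \<subseteq> {1..} \<and> finite S \<and> card S = l \<and> \<Sum>S = k \<and>
        real (card (sumset S)) \<le> lam * real l})
      \<le> 2 powr (d * real l) * ((4 * lam - 3) * exp 1 / 6) ^ l"
      by (simp only: X_def base_def)
  qed
qed

end
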